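(* Let $H$ be a complex Hilbert space and let $A$ and $B$ be two bounded normal operators on $H$ such that $AB=\lambda BA\neq 0$, where $\lambda\in\mathbb{C}$. Then $AB$ (and also $BA$) is normal, for any non-zero $\lambda$.
   Context: The condition $AB=\lambda BA\neq 0$ means that $AB=\lambda BA$ and that this operator is not the zero operator (in particular $\lambda\neq 0$). *)

theory Defs
  imports "HOL-Analysis.Analysis"
begin

text \<open>
  A complex Hilbert space is a type of the class \<open>complex_hilbert_space\<close>.  The norm, metric and
  completeness are those of the library classes \<open>real_normed_vector\<close> and \<open>complete_space\<close>; the
  complex structure is required to extend the real one.  The inner product is linear in the first
  and conjugate-linear in the second argument.
\<close>

class complex_vector = real_vector +
  fixes scaleC :: "complex \<Rightarrow> 'a \<Rightarrow> 'a"  (infixr \<open>*\<^sub>C\<close> 75)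
  assumes scaleC_add_right: "a *\<^sub>C (x + y) = a *\<^sub>C x + a *\<^sub>C y"
    and scaleC_add_left: "(a + b) *\<^sub>C x = a *\<^sub>C x + b *\<^sub>C x"
    and scaleC_scaleC: "a *\<^sub>C b *\<^sub>C x = (a * b) *\<^sub>C x"
    and scaleR_scaleC: "r *\<^sub>R x = complex_of_real r *\<^sub>C x"

class complex_inner = complex_vector + real_normed_vector +
  fixes cinner :: "'a \<Rightarrow> 'a \<Rightarrow> complex"
  assumes cinner_commute: "cinner x y = cnj (cinner y x)"
    and cinner_add_left: "cinner (x + y) z = cinner x z + cinner y z"
    and cinner_scaleC_left: "cinner (a *\<^sub>C x) y = a * cinner x y"
    and cinner_ge_zero: "0 \<le> Re (cinner x x)"
    and cinner_eq_zero_iff: "cinner x x = 0 \<longleftrightarrow> x = 0"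
    and norm_eq_sqrt_cinner: "norm x = sqrt (Re (cinner x x))"

class complex_hilbert_space = complex_inner + complete_space

locale bounded_clinear = bounded_linear f
  for f :: "'a::complex_inner \<Rightarrow> 'b::complex_inner" +
  assumes scaleC: "f (c *\<^sub>C x) = c *\<^sub>C f x"

text \<open>
  As for the library constant \<open>adjoint\<close>, the Hilbert-space adjoint is obtained by choice;
  existence and uniqueness for bounded operators are the lemmas \<open>cadjoint_works\<close> and
  \<open>cadjoint_unique\<close>.
\<close>

definition cadjoint :: "('a::complex_inner \<Rightarrow> 'b::complex_inner) \<Rightarrow> 'b \<Rightarrow> 'a" where
  "cadjoint f = (SOME g. \<forall>x y. cinner (f x) y = cinner x (g y))"

definition normal_operator :: "('a::complex_hilbert_space \<Rightarrow> 'a) \<Rightarrow> bool" where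
  "normal_operator f \<longleftrightarrow> bounded_clinear f \<and> f \<circ> cadjoint f = cadjoint f \<circ> f"

instantiation complex :: complex_hilbert_space
begin

definition scaleC_complex :: "complex \<Rightarrow> complex \<Rightarrow> complex" where
  "scaleC_complex a x = a * x"

definition cinner_complex :: "complex \<Rightarrow> complex \<Rightarrow> complex" where
  "cinner_complex x y = x * cnj y"

instance
  by standard
    (auto simp: scaleC_complex_def cinner_complex_def algebra_simps scaleR_conv_of_real
      cmod_def power2_eq_square)

end

lemma cinner_add_right: "cinner x (y + z) = cinner x y + cinner x z"
  by (metis cinner_add_left cinner_commute complex_cnj_add)

lemma cinner_scaleC_right: "cinner x (a *\<^sub>C y) = cnj a * cinner x y"
  by (metis cinner_commute cinner_scaleC_left complex_cnj_mult)

lemma cinner_scaleR_left: "cinner (r *\<^sub>R x) y = of_real r * cinner x y"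
  by (simp add: scaleR_scaleC cinner_scaleC_left)

lemma cinner_scaleR_right: "cinner x (r *\<^sub>R y) = of_real r * cinner x y"
  by (simp add: scaleR_scaleC cinner_scaleC_right)

lemma cinner_diff_right: "cinner x (y - z) = cinner x y - cinner x z"
  by (metis add_diff_cancel_right' cinner_add_right diff_add_cancel)

lemma Re_cinner_commute: "Re (cinner x y) = Re (cinner y x)"
  by (metis cinner_commute complex_cnj(1) complex.sel(1) complex_surj cnj.sel(1))

lemma norm_power2_eq_cinner: "(norm x)\<^sup>2 = Re (cinner x x)"
  by (simp add: norm_eq_sqrt_cinner cinner_ge_zero)

lemma norm_add_power2:
  "(norm (x + y :: 'a::complex_inner))\<^sup>2 = (norm x)\<^sup>2 + 2 * Re (cinner x y) + (norm y)\<^sup>2"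
  using Re_cinner_commute[of x y]
  by (simp add: norm_power2_eq_cinner cinner_add_left cinner_add_right)

lemma Re_cinner_le: "Re (cinner x y) \<le> norm x * norm (y :: 'a::complex_inner)"
proof -
  have "(norm (x + y))\<^sup>2 \<le> (norm x + norm y)\<^sup>2"
    by (intro power_mono norm_triangle_ineq norm_ge_zero)
  then show ?thesis
    unfolding norm_add_power2 by (simp add: power2_sum)
qed

lemma norm_parallelogram:
  fixes x y :: "'a::complex_inner"
  shows "(norm (x + y))\<^sup>2 + (norm (x - y))\<^sup>2 = 2 * (norm x)\<^sup>2 + 2 * (norm y)\<^sup>2"
  using norm_add_power2[of x y] norm_add_power2[of x "-y"] cinner_add_right[of x y "-y"]
    cinner_scaleR_right[of x "-1" y] by simp

text \<open>Riesz representation, by minimising \<open>(norm x)\<^sup>2 - 2 * g x\<close>.\<close>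

lemma riesz_Re:
  fixes g :: "'a::complex_hilbert_space \<Rightarrow> real"
  assumes "bounded_linear g"
  shows "\<exists>u. \<forall>x. g x = Re (cinner x u)"
proof -
  interpret g: bounded_linear g by fact
  define J where "J x = (norm x)\<^sup>2 - 2 * g x" for x
  obtain K where K: "\<And>x. norm (g x) \<le> norm x * K"
    using g.bounded by blast
  have low: "- K\<^sup>2 \<le> J x" for x
  proof -
    have "g x \<le> norm x * K" using K[of x] by simp
    moreover have "0 \<le> (norm x - K)\<^sup>2" by simp
    ultimately show ?thesis
      unfolding J_def by (simp add: power2_diff)
  qed
  define m where "m = (INF x. J x)"
  have bdd: "bdd_below (range J)" using low by (auto intro!: bdd_belowI)
  have m_le: "m \<le> J x" for x
    unfolding m_def by (intro cINF_lower bdd) auto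
  have "\<exists>x. J x < m + 1 / Suc n" for n
    using cINF_less_iff[OF _ bdd, of "m + 1 / Suc n"] by (auto simp: m_def)
  then obtain X where X: "\<And>n. J (X n) < m + 1 / Suc n" by metis
  have mid: "(norm (x - y))\<^sup>2 \<le> 2 * (J x + J y - 2 * m)" for x y
  proof -
    have "(norm ((1/2) *\<^sub>R (x + y)))\<^sup>2 = (norm (x + y))\<^sup>2 / 4"
      by (simp add: power_divide)
    moreover have "g ((1/2) *\<^sub>R (x + y)) = (g x + g y) / 2"
      by (simp only: g.scaleR g.add) simp
    ultimately have "4 * J ((1/2) *\<^sub>R (x + y)) = (norm (x + y))\<^sup>2 - 4 * (g x + g y)"
      unfolding J_def by simp
    with m_le[of "(1/2) *\<^sub>R (x + y)"] norm_parallelogram[of x y]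
    show ?thesis unfolding J_def by argo
  qed
  have "Cauchy X"
  proof (rule metric_CauchyI)
    fix e :: real assume e: "0 < e"
    then obtain N where N: "1 / real (Suc N) < e\<^sup>2 / 4"
      using nat_approx_posE[of "e\<^sup>2 / 4"] by auto
    show "\<exists>M. \<forall>k\<ge>M. \<forall>n\<ge>M. dist (X k) (X n) < e"
    proof (intro exI allI impI)
      fix k n assume kn: "k \<ge> N" "n \<ge> N"
      have "1 / real (Suc k) \<le> 1 / real (Suc N)" "1 / real (Suc n) \<le> 1 / real (Suc N)"
        using kn by (auto intro!: divide_left_mono)
      with X[of k] X[of n] mid[of "X k" "X n"] N
      have "(norm (X k - X n))\<^sup>2 < e\<^sup>2" by argo
      then show "dist (X k) (X n) < e"
        using e by (simp add: dist_norm power2_less_imp_less)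
    qed
  qed
  then obtain u where u: "X \<longlonglongrightarrow> u"
    using Cauchy_convergent_iff convergent_def by blast
  have "(\<lambda>n. J (X n)) \<longlonglongrightarrow> J u"
    unfolding J_def by (intro tendsto_intros g.tendsto u)
  moreover have "(\<lambda>n. m + 1 / Suc n) \<longlonglongrightarrow> m + 0"
    by (intro tendsto_intros LIMSEQ_Suc[OF lim_1_over_n])
  ultimately have "J u \<le> m + 0"
    using X by (intro LIMSEQ_le[of "\<lambda>n. J (X n)"]) (auto intro!: less_imp_le)
  then have min: "J u \<le> J x" for x using m_le[of x] by simp
  have "g x = Re (cinner x u)" for x
  proof (rule ccontr)
    assume ne: "g x \<noteq> Re (cinner x u)"
    define d where "d = Re (cinner x u) - g x"
    define t where "t = - d / ((norm x)\<^sup>2 + 1)"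
    have pos: "(norm x)\<^sup>2 + 1 > 0" by (simp add: add_nonneg_pos)
    have "J (u + t *\<^sub>R x) = J u + t\<^sup>2 * (norm x)\<^sup>2 + 2 * t * d"
      unfolding J_def norm_add_power2 d_def
      by (simp add: g.add g.scaleR cinner_scaleR_right Re_cinner_commute[of u x]
          power_mult_distrib algebra_simps)
    with min[of "u + t *\<^sub>R x"] have "0 \<le> t\<^sup>2 * (norm x)\<^sup>2 + 2 * t * d" by simp
    moreover have "t\<^sup>2 * ((norm x)\<^sup>2 + 1) = - t * d"
      using pos unfolding t_def by (simp add: power2_eq_square)
    ultimately have "t\<^sup>2 \<le> t * d" by (simp add: algebra_simps)
    moreover have "t * d < 0"
      using ne pos unfolding t_def d_def by (simp add: divide_less_0_iff mult_less_0_iff; linarith)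
    ultimately show False using zero_le_power2[of t] by linarith
  qed
  then show ?thesis by blast
qed

lemma cadjoint_works:
  fixes f :: "'a::complex_hilbert_space \<Rightarrow> 'b::complex_inner"
  assumes "bounded_clinear f"
  shows "cinner (f x) y = cinner x (cadjoint f y)"
proof -
  interpret f: bounded_clinear f by fact
  have "\<exists>u. \<forall>x. cinner (f x) y = cinner x u" for y
  proof -
    have "bounded_linear (\<lambda>z. Re (cinner z y))"
    proof (rule bounded_linear_intro[where K = "norm y"])
      fix z :: 'b
      show "norm (Re (cinner z y)) \<le> norm z * norm y"
        using Re_cinner_le[of z y] Re_cinner_le[of "- z" y] cinner_scaleR_left[of "-1" z y]
        by (simp add: abs_le_iff)
    qed (simp_all add: cinner_add_left cinner_scaleR_left)
    from bounded_linear_compose[OF this f.bounded_linear_axioms]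
    obtain u where u: "\<And>x. Re (cinner (f x) y) = Re (cinner x u)"
      using riesz_Re by blast
    have "cinner (f x) y = cinner x u" for x
      using u[of x] u[of "\<i> *\<^sub>C x"]
      by (intro complex_eqI) (simp_all add: f.scaleC cinner_scaleC_left)
    then show ?thesis by blast
  qed
  then have "\<exists>g. \<forall>x y. cinner (f x) y = cinner x (g y)" by metis
  then have "\<forall>x y. cinner (f x) y = cinner x (cadjoint f y)"
    unfolding cadjoint_def by (rule someI_ex)
  then show ?thesis by blast
qed

lemma cadjoint_unique:
  fixes f :: "'a::complex_hilbert_space \<Rightarrow> 'b::complex_inner"
  assumes "bounded_clinear f" and "\<And>x y. cinner (f x) y = cinner x (g y)"
  shows "g = cadjoint f"
proof
  fix y
  have "cinner x (g y - cadjoint f y) = 0" for x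
    using assms(2)[of x y] cadjoint_works[OF assms(1), of x y] by (simp add: cinner_diff_right)
  then show "g y = cadjoint f y"
    using cinner_eq_zero_iff[of "g y - cadjoint f y"] by simp
qed

end

theory Submission
  imports Defs "HOL-Complex_Analysis.Cauchy_Integral_Formula"
begin

text \<open>
  Normality of \<open>A B\<close> is a formal consequence of the Fuglede--Putnam theorem: if \<open>M\<close> and \<open>N\<close> are
  normal and \<open>M X = X N\<close>, then \<open>M* X = X N*\<close>.  Applied to \<open>A B = (\<lambda> B) A\<close>, it gives the commutation
  of \<open>A\<close> with \<open>B*\<close> and of \<open>B\<close> with \<open>A*\<close> up to scalars.

  Fuglede--Putnam needs neither the spectral theorem nor exponentials here.  Since
  \<open>p(M)\<close> and \<open>p(N)\<close> are normal, \<open>\<parallel>p(M)* X z\<parallel> = \<parallel>p(M) X z\<parallel> = \<parallel>X p(N) z\<parallel> \<le> \<parallel>X\<parallel> \<parallel>p(N)* z\<parallel>\<close> for every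
  polynomial \<open>p\<close>.  Hence \<open>F(w) = (1 + w M*)\<^sup>n X (1 - w N*)\<^sup>n y\<close> satisfies
  \<open>\<parallel>F(w)\<parallel> \<le> \<parallel>X\<parallel> (1 + |w|\<^sup>2 \<parallel>N*\<parallel>\<^sup>2)\<^sup>n \<parallel>y\<parallel>\<close>, which stays bounded on the circle \<open>|w| = 1 / sqrt n\<close>.
  As \<open>F'(0) = n (M* X - X N*) y\<close>, Cauchy's estimate gives \<open>sqrt n \<parallel>(M* X - X N*) y\<parallel> = O(1)\<close>.
\<close>

section \<open>Inner product and adjoint\<close>

lemma scaleC_one [simp]: "1 *\<^sub>C x = (x :: 'a::complex_inner)"
  using scaleR_scaleC[of 1 x] by simp

lemma scaleC_zero_left [simp]: "0 *\<^sub>C x = (0 :: 'a::complex_inner)"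
  using scaleR_scaleC[of 0 x] by simp

lemma scaleC_minus_one: "(-1) *\<^sub>C x = - (x :: 'a::complex_inner)"
  using scaleR_scaleC[of "-1" x] by simp

lemma scaleC_minus_right: "a *\<^sub>C (- x) = - (a *\<^sub>C (x :: 'a::complex_inner))"
  using scaleC_scaleC[of a "-1" x] scaleC_scaleC[of "-1" a x] by (simp add: scaleC_minus_one)

lemma scaleC_diff_right: "a *\<^sub>C (x - y) = a *\<^sub>C x - a *\<^sub>C (y :: 'a::complex_inner)"
  using scaleC_add_right[of a x "- y"] by (simp add: scaleC_minus_right)

lemma cinner_zero_left [simp]: "cinner 0 (x :: 'a::complex_inner) = 0"
  using cinner_scaleC_left[of 0 0 x] by simp

lemma norm_scaleC: "norm (a *\<^sub>C x) = cmod a * norm (x :: 'a::complex_inner)"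
proof -
  have "cinner (a *\<^sub>C x) (a *\<^sub>C x) = of_real ((cmod a)\<^sup>2) * cinner x x"
    by (simp only: cinner_scaleC_left cinner_scaleC_right complex_norm_square mult_ac)
  then have "(norm (a *\<^sub>C x))\<^sup>2 = (cmod a * norm x)\<^sup>2"
    by (simp add: norm_power2_eq_cinner[of x] norm_power2_eq_cinner[of "a *\<^sub>C x"]
        power_mult_distrib flip: of_real_power)
  then show ?thesis
    by (simp add: power2_eq_iff_nonneg)
qed

lemma cmod_cinner_le: "cmod (cinner x y) \<le> norm x * norm (y :: 'a::complex_inner)"
proof (cases "cinner x y = 0")
  case False
  \<comment> \<open>A unimodular factor rotating \<open>cinner x y\<close> onto the positive real
    axis, so that the bound on real parts suffices.\<close>
  define a where "a = cnj (cinner x y) / cmod (cinner x y)"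
  have a: "cmod a = 1"
    using False by (simp add: a_def norm_divide)
  have "cinner (a *\<^sub>C x) y = cmod (cinner x y)"
    using False complex_norm_square[of "cinner x y"]
    by (simp add: cinner_scaleC_left a_def divide_simps power2_eq_square mult.commute)
  then show ?thesis
    using Re_cinner_le[of "a *\<^sub>C x" y] by (simp add: norm_scaleC a)
qed simp

lemma cinner_ext:
  fixes x y :: "'a::complex_inner"
  assumes "\<And>v. cinner v x = cinner v y"
  shows "x = y"
  using assms[of "x - y"] cinner_diff_right[of "x - y" x y] cinner_eq_zero_iff[of "x - y"] by simp

lemma bounded_clinear_intro:
  fixes f :: "'a::complex_inner \<Rightarrow> 'b::complex_inner"
  assumes "\<And>x y. f (x + y) = f x + f y" and "\<And>c x. f (c *\<^sub>C x) = c *\<^sub>C f x"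
    and "\<And>x. norm (f x) \<le> norm x * K"
  shows "bounded_clinear f"
proof -
  have "bounded_linear f"
    using assms by (intro bounded_linear_intro[where K = K]) (simp_all add: scaleR_scaleC)
  then show ?thesis
    using assms(2) by (simp add: bounded_clinear_def bounded_clinear_axioms_def)
qed

lemma bounded_clinear_compose:
  assumes "bounded_clinear f" and "bounded_clinear g"
  shows "bounded_clinear (f \<circ> g)"
proof -
  interpret f: bounded_clinear f by fact
  interpret g: bounded_clinear g by fact
  have "bounded_linear (f \<circ> g)"
    using bounded_linear_compose[OF f.bounded_linear_axioms g.bounded_linear_axioms]
    by (simp add: comp_def)
  then show ?thesis
    by (simp add: bounded_clinear_def bounded_clinear_axioms_def f.scaleC g.scaleC)
qed

lemma bounded_clinear_scaleC:
  assumes "bounded_clinear f"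
  shows "bounded_clinear (\<lambda>x. c *\<^sub>C f x)"
proof -
  interpret f: bounded_clinear f by fact
  obtain K where K: "\<And>x. norm (f x) \<le> norm x * K"
    using f.bounded by blast
  show ?thesis
  proof (rule bounded_clinear_intro[where K = "cmod c * K"])
    show "norm (c *\<^sub>C f x) \<le> norm x * (cmod c * K)" for x
      using mult_left_mono[OF K[of x], of "cmod c"] by (simp add: norm_scaleC algebra_simps)
  qed (simp_all add: f.add f.scaleC scaleC_add_right scaleC_scaleC mult.commute)
qed

text \<open>With z = \<open>cadjoint f y\<close>, the square of norm z is Re <f z, y>, hence at most
  K norm z norm y, and one norm z cancels. Linearity follows by testing against every
  vector.\<close>

lemma bounded_clinear_cadjoint:
  fixes f :: "'a::complex_hilbert_space \<Rightarrow> 'b::complex_inner"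
  assumes "bounded_clinear f"
  shows "bounded_clinear (cadjoint f)"
proof -
  interpret f: bounded_clinear f by fact
  obtain K where K: "K > 0" "\<And>x. norm (f x) \<le> norm x * K"
    using f.pos_bounded by blast
  note adj = cadjoint_works[OF assms, symmetric]
  show ?thesis
  proof (rule bounded_clinear_intro[where K = K])
    fix y
    let ?z = "cadjoint f y"
    have "norm ?z * norm ?z = Re (cinner (f ?z) y)"
      using norm_power2_eq_cinner[of ?z] by (simp add: power2_eq_square adj)
    also have "\<dots> \<le> norm (f ?z) * norm y"
      by (rule Re_cinner_le)
    also have "\<dots> \<le> norm ?z * K * norm y"
      using K(2)[of ?z] by (rule mult_right_mono) simp
    finally have "norm ?z * norm ?z \<le> norm ?z * (norm y * K)"
      by (simp add: mult_ac)
    then show "norm ?z \<le> norm y * K"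
      using K(1) by (cases "norm ?z = 0") (simp_all add: mult_le_cancel_left)
  qed (rule cinner_ext, simp add: adj cinner_add_right cinner_scaleC_right)+
qed

lemma cadjoint_scaleC:
  fixes f :: "'a::complex_hilbert_space \<Rightarrow> 'b::complex_inner"
  assumes "bounded_clinear f"
  shows "cadjoint (\<lambda>x. c *\<^sub>C f x) = (\<lambda>x. cnj c *\<^sub>C cadjoint f x)"
  by (rule cadjoint_unique[symmetric, OF bounded_clinear_scaleC[OF assms]])
    (simp add: cinner_scaleC_left cinner_scaleC_right cadjoint_works[OF assms])

lemma cadjoint_compose:
  fixes f :: "'b::complex_hilbert_space \<Rightarrow> 'c::complex_inner"
    and g :: "'a::complex_hilbert_space \<Rightarrow> 'b"
  assumes "bounded_clinear f" and "bounded_clinear g"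
  shows "cadjoint (f \<circ> g) = cadjoint g \<circ> cadjoint f"
  by (rule cadjoint_unique[symmetric, OF bounded_clinear_compose[OF assms]])
    (simp add: cadjoint_works[OF assms(1)] cadjoint_works[OF assms(2)])

lemma normal_operator_scaleC:
  assumes "normal_operator f"
  shows "normal_operator (\<lambda>x. c *\<^sub>C f x)"
proof -
  have f: "bounded_clinear f" and comm: "f (cadjoint f x) = cadjoint f (f x)" for x
    using assms by (auto simp: normal_operator_def fun_eq_iff)
  interpret f: bounded_clinear f by fact
  interpret f': bounded_clinear "cadjoint f" by (rule bounded_clinear_cadjoint[OF f])
  show ?thesis
    using bounded_clinear_scaleC[OF f]
    by (simp add: normal_operator_def cadjoint_scaleC[OF f] fun_eq_iff f.scaleC f'.scaleC
        scaleC_scaleC comm mult.commute)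
qed

section \<open>Iterates of \<open>1 + w L\<close>\<close>

text \<open>Keeping \<open>w\<close> as a separate argument lets \<open>^^\<close> form the
  polynomials (1 + w L)^n while the result can still be differentiated in \<open>w\<close>.\<close>

definition add_scaled :: "('a::complex_inner \<Rightarrow> 'a) \<Rightarrow> complex \<Rightarrow> 'a \<Rightarrow> 'a" where
  "add_scaled L w x = x + w *\<^sub>C L x"

lemma funpow_commute:
  fixes f g :: "'a \<Rightarrow> 'a"
  assumes "\<And>x. f (g x) = g (f x)"
  shows "(f ^^ n) (g x) = g ((f ^^ n) x)"
  by (induction n) (simp_all add: assms)

lemma funpow_intertwine:
  fixes f :: "'b \<Rightarrow> 'b" and g :: "'a \<Rightarrow> 'a" and h :: "'a \<Rightarrow> 'b"
  assumes "\<And>x. f (h x) = h (g x)"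
  shows "(f ^^ n) (h x) = h ((g ^^ n) x)"
  by (induction n) (simp_all add: assms)

lemma funpow_compose:
  fixes f g :: "'a \<Rightarrow> 'a"
  assumes "\<And>x. f (g x) = g (f x)"
  shows "(f ^^ n) ((g ^^ n) x) = ((f \<circ> g) ^^ n) x"
proof (induction n arbitrary: x)
  case (Suc n)
  have "(f ^^ Suc n) ((g ^^ Suc n) x) = f (g ((f ^^ n) ((g ^^ n) x)))"
    by (simp add: funpow_commute[of f g, OF assms])
  then show ?case
    by (simp add: Suc)
qed simp

lemma norm_funpow_le:
  fixes f :: "'a::real_normed_vector \<Rightarrow> 'a"
  assumes "\<And>x. norm (f x) \<le> c * norm x" and "0 \<le> c"
  shows "norm ((f ^^ n) x) \<le> c ^ n * norm x"
proof (induction n)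
  case (Suc n)
  have "norm ((f ^^ Suc n) x) \<le> c * norm ((f ^^ n) x)"
    by (simp add: assms(1))
  also have "\<dots> \<le> c * (c ^ n * norm x)"
    using Suc assms(2) by (rule mult_left_mono)
  finally show ?case by (simp add: mult.assoc)
qed simp

lemma cinner_funpow_adjoint:
  fixes f g :: "'a::complex_inner \<Rightarrow> 'a"
  assumes "\<And>x y. cinner (f x) y = cinner x (g y)"
  shows "cinner ((f ^^ n) x) y = cinner x ((g ^^ n) y)"
proof (induction n arbitrary: x y)
  case (Suc n)
  have "cinner ((f ^^ Suc n) x) y = cinner x ((g ^^ n) (g y))"
    by (simp add: assms Suc)
  then show ?case
    by (simp only: funpow.simps o_apply funpow_swap1[of g n])
qed simp

text \<open><f x, f x> = <x, g (f x)> = <x, f (g x)> = <g x, g x>, moving one factor across at each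
  end.\<close>

lemma norm_eq_if_commuting_adjoint:
  assumes "\<And>x y. cinner (f x) y = cinner x (g y)" and "\<And>x. f (g x) = g (f x)"
  shows "norm (f x) = norm (g x)"
proof -
  have "cinner (f x) (f x) = cinner x (f (g x))"
    by (simp add: assms)
  also have "\<dots> = cinner (g x) (g x)"
    by (metis assms(1) cinner_commute)
  finally show ?thesis
    by (simp add: norm_eq_sqrt_cinner)
qed

text \<open>The two iterates are adjoint to each other, the scalar being conjugated as it crosses
  the inner product, and normality of \<open>f\<close> makes them commute.\<close>

lemma norm_funpow_add_scaled_adjoint:
  fixes f :: "'a::complex_hilbert_space \<Rightarrow> 'a"
  assumes "normal_operator f"
  shows "norm ((add_scaled f (cnj w) ^^ n) x) = norm ((add_scaled (cadjoint f) w ^^ n) x)"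
proof (rule norm_eq_if_commuting_adjoint[where f = "add_scaled f (cnj w) ^^ n"
      and g = "add_scaled (cadjoint f) w ^^ n"])
  have f: "bounded_clinear f" and comm: "f (cadjoint f x) = cadjoint f (f x)" for x
    using assms by (auto simp: normal_operator_def fun_eq_iff)
  interpret f: bounded_clinear f by fact
  interpret f': bounded_clinear "cadjoint f" by (rule bounded_clinear_cadjoint[OF f])
  have adj: "cinner (add_scaled f (cnj w) x) y = cinner x (add_scaled (cadjoint f) w y)" for x y
    by (simp add: add_scaled_def cinner_add_left cinner_add_right cinner_scaleC_left
        cinner_scaleC_right cadjoint_works[OF f])
  then show "cinner ((add_scaled f (cnj w) ^^ n) x) y
      = cinner x ((add_scaled (cadjoint f) w ^^ n) y)" for x y
    by (rule cinner_funpow_adjoint)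
  have "add_scaled f (cnj w) (add_scaled (cadjoint f) w x)
      = add_scaled (cadjoint f) w (add_scaled f (cnj w) x)" for x
    by (simp add: add_scaled_def f.add f.scaleC f'.add f'.scaleC scaleC_add_right scaleC_scaleC
        comm mult.commute add_ac)
  then show "(add_scaled f (cnj w) ^^ n) ((add_scaled (cadjoint f) w ^^ n) x)
      = (add_scaled (cadjoint f) w ^^ n) ((add_scaled f (cnj w) ^^ n) x)" for x
    by (intro funpow_commute funpow_commute[symmetric]) simp
qed

section \<open>Weakly holomorphic vector-valued functions\<close>

text \<open>Testing against fixed vectors reduces vector-valued calculus to entire scalar functions,
  to which Cauchy's estimate applies.\<close>

definition weak_deriv :: "(complex \<Rightarrow> 'a::complex_inner) \<Rightarrow> (complex \<Rightarrow> 'a) \<Rightarrow> bool" where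
  "weak_deriv f f' \<longleftrightarrow>
    (\<forall>w v. ((\<lambda>w. cinner (f w) v) has_field_derivative cinner (f' w) v) (at w))"

lemma weak_deriv_const: "weak_deriv (\<lambda>w. y) (\<lambda>w. 0)"
  by (simp add: weak_deriv_def)

text \<open>The adjoint moves \<open>L\<close> onto the test vector, so this is the assumption
  tested against \<open>cadjoint L v\<close>.\<close>

lemma weak_deriv_bounded_clinear:
  fixes L :: "'a::complex_hilbert_space \<Rightarrow> 'b::complex_inner"
  assumes "bounded_clinear L" and "weak_deriv f f'"
  shows "weak_deriv (\<lambda>w. L (f w)) (\<lambda>w. L (f' w))"
  using assms(2) by (simp add: weak_deriv_def cadjoint_works[OF assms(1)])

lemma weak_deriv_add_scaled:
  fixes L :: "'a::complex_hilbert_space \<Rightarrow> 'a"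
  assumes "bounded_clinear L" and "weak_deriv f f'"
  shows "weak_deriv (\<lambda>w. add_scaled L w (f w)) (\<lambda>w. add_scaled L w (f' w) + L (f w))"
  unfolding weak_deriv_def
proof (intro allI)
  fix w v
  have "((\<lambda>w. cinner (f w) v + w * cinner (L (f w)) v) has_field_derivative
      cinner (f' w) v + (w * cinner (L (f' w)) v + 1 * cinner (L (f w)) v)) (at w)"
    using assms(2) weak_deriv_bounded_clinear[OF assms]
    by (intro DERIV_add DERIV_mult' DERIV_ident) (simp_all add: weak_deriv_def)
  then show "((\<lambda>w. cinner (add_scaled L w (f w)) v) has_field_derivative
      cinner (add_scaled L w (f' w) + L (f w)) v) (at w)"
    by (simp add: add_scaled_def cinner_add_left cinner_scaleC_left add_ac)
qed

lemma add_scaled_zero [simp]: "add_scaled L 0 = id"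
  by (simp add: add_scaled_def fun_eq_iff)

text \<open>Cauchy's estimate will only use the derivative at 0. There every factor is the identity,
  and the product rule collects one \<open>L (f 0)\<close> per factor.\<close>

lemma weak_deriv_funpow_add_scaled:
  fixes L :: "'a::complex_hilbert_space \<Rightarrow> 'a"
  assumes "bounded_clinear L" and "weak_deriv f f'"
  obtains g' where "weak_deriv (\<lambda>w. (add_scaled L w ^^ n) (f w)) g'"
    and "g' 0 = f' 0 + of_nat n *\<^sub>C L (f 0)"
proof -
  have "\<exists>g'. weak_deriv (\<lambda>w. (add_scaled L w ^^ n) (f w)) g' \<and>
      g' 0 = f' 0 + of_nat n *\<^sub>C L (f 0)"
  proof (induction n)
    case 0
    then show ?case using assms(2) by auto
  next
    case (Suc n)
    then obtain g' where "weak_deriv (\<lambda>w. (add_scaled L w ^^ n) (f w)) g'"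
      and g': "g' 0 = f' 0 + of_nat n *\<^sub>C L (f 0)"
      by blast
    from weak_deriv_add_scaled[OF assms(1) this(1)] show ?case
      by (intro exI[of _ "\<lambda>w. add_scaled L w (g' w) + L ((add_scaled L w ^^ n) (f w))"])
        (simp add: g' scaleC_add_left add_ac)
  qed
  with that show thesis by blast
qed

text \<open>Testing against \<open>f' 0\<close> itself, the scalar Cauchy estimate bounds the square
  of its norm, and one norm cancels.\<close>

lemma weak_deriv_Cauchy_bound:
  assumes "weak_deriv f f'" and "0 < r" and bound: "\<And>w. cmod w \<le> r \<Longrightarrow> norm (f w) \<le> C"
  shows "norm (f' 0) \<le> C / r"
proof (cases "f' 0 = 0")
  case True
  have "0 \<le> C"
    using order_trans[OF norm_ge_zero bound[of 0]] assms(2) by simp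
  with True assms(2) show ?thesis by simp
next
  case False
  define v where "v = f' 0"
  define h where "h = (\<lambda>w. cinner (f w) v)"
  have h: "(h has_field_derivative cinner (f' w) v) (at w)" for w
    using assms(1) by (simp add: weak_deriv_def h_def)
  then have hol: "h holomorphic_on S" for S
    using holomorphic_on_open holomorphic_on_subset open_UNIV by (metis subset_UNIV)
  have "cmod ((deriv ^^ 1) h 0) \<le> fact 1 * (C * norm v) / r ^ 1"
  proof (rule Cauchy_inequality)
    fix w assume "cmod (0 - w) = r"
    then show "cmod (h w) \<le> C * norm v"
      using cmod_cinner_le[of "f w" v] mult_right_mono[OF bound[of w], of "norm v"]
      by (simp add: h_def)
  qed (auto intro!: hol holomorphic_on_imp_continuous_on assms(2))
  then have "cmod (cinner v v) \<le> C * norm v / r"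
    using DERIV_imp_deriv[OF h[of 0]] by (simp add: v_def)
  moreover have "norm v * norm v \<le> cmod (cinner v v)"
    using norm_power2_eq_cinner[of v] complex_Re_le_cmod[of "cinner v v"]
    by (simp add: power2_eq_square)
  ultimately have "norm v * norm v \<le> (C / r) * norm v"
    by simp
  moreover have "0 < norm v"
    using False by (simp add: v_def)
  ultimately show ?thesis
    unfolding v_def by (rule mult_right_le_imp_le)
qed

section \<open>The Fuglede--Putnam theorem\<close>

text \<open>\<open>X\<close> intertwines the powers of 1 + cnj(w) M and 1 + cnj(w) N. Normality then
  passes to the adjoint powers on both sides without changing norms, although \<open>X\<close> is
  not yet known to intertwine those.\<close>

lemma norm_funpow_add_scaled_intertwine_le:
  fixes M N X :: "'a::complex_hilbert_space \<Rightarrow> 'a"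
  assumes M: "normal_operator M" and N: "normal_operator N" and X: "bounded_clinear X"
    and MX: "\<And>x. M (X x) = X (N x)" and K: "\<And>x. norm (X x) \<le> norm x * K"
  shows "norm ((add_scaled (cadjoint M) w ^^ n) (X z))
    \<le> norm ((add_scaled (cadjoint N) w ^^ n) z) * K"
proof -
  interpret X: bounded_clinear X by fact
  have "(add_scaled M (cnj w) ^^ n) (X z) = X ((add_scaled N (cnj w) ^^ n) z)"
    by (rule funpow_intertwine) (simp add: add_scaled_def X.add X.scaleC MX)
  then show ?thesis
    using K[of "(add_scaled N (cnj w) ^^ n) z"]
    by (simp add: norm_funpow_add_scaled_adjoint[OF M, symmetric]
        norm_funpow_add_scaled_adjoint[OF N, symmetric])
qed

text \<open>1 + w T and 1 - w T commute, so their powers merge into (1 - w^2 T^2)^n. The loss of the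
  linear term is what allows a radius as large as 1 / sqrt n.\<close>

lemma norm_funpow_add_scaled_minus_le:
  fixes T :: "'a::complex_inner \<Rightarrow> 'a"
  assumes "bounded_clinear T" and R: "\<And>x. norm (T x) \<le> norm x * R" and "0 \<le> R"
  shows "norm ((add_scaled T w ^^ n) ((add_scaled (\<lambda>x. (-1) *\<^sub>C T x) w ^^ n) y))
    \<le> (1 + (cmod w * R)\<^sup>2) ^ n * norm y"
proof -
  interpret T: bounded_clinear T by fact
  let ?p = "add_scaled T w" and ?q = "add_scaled (\<lambda>x. (-1) *\<^sub>C T x) w"
  have pq: "?p (?q x) = x - (w * w) *\<^sub>C T (T x)" and qp: "?q (?p x) = ?p (?q x)" for x
    by (simp_all add: add_scaled_def T.diff T.add T.neg T.scaleC scaleC_add_right scaleC_scaleC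
        scaleC_minus_one scaleC_minus_right scaleC_diff_right)
  have "norm (T (T x)) \<le> norm x * R * R" for x
    using R[of "T x"] mult_right_mono[OF R[of x] \<open>0 \<le> R\<close>] by linarith
  then have "cmod (w * w) * norm (T (T x)) \<le> cmod (w * w) * (norm x * R * R)" for x
    by (intro mult_left_mono) simp_all
  then have "norm ((?p \<circ> ?q) x) \<le> (1 + (cmod w * R)\<^sup>2) * norm x" for x
    using norm_triangle_ineq4[of x "(w * w) *\<^sub>C T (T x)"]
    by (simp add: pq norm_scaleC norm_mult power2_eq_square algebra_simps) (smt (verit))
  then have "norm (((?p \<circ> ?q) ^^ n) y) \<le> (1 + (cmod w * R)\<^sup>2) ^ n * norm y"
    by (intro norm_funpow_le) simp_all
  then show ?thesis
    by (simp add: funpow_compose[of ?p ?q] qp)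
qed

theorem Fuglede_Putnam:
  fixes M N X :: "'a::complex_hilbert_space \<Rightarrow> 'a"
  assumes M: "normal_operator M" and N: "normal_operator N" and X: "bounded_clinear X"
    and MX: "\<And>x. M (X x) = X (N x)"
  shows "cadjoint M (X y) = X (cadjoint N y)"
proof -
  define S T where "S = cadjoint M" and "T = cadjoint N"
  have S: "bounded_clinear S" and T: "bounded_clinear T"
    using M N by (auto simp: S_def T_def normal_operator_def intro: bounded_clinear_cadjoint)
  interpret X: bounded_clinear X by fact
  interpret T: bounded_clinear T by fact
  obtain K where K: "0 < K" "\<And>x. norm (X x) \<le> norm x * K"
    using X.pos_bounded by blast
  obtain R where R: "0 < R" "\<And>x. norm (T x) \<le> norm x * R"
    using T.pos_bounded by blast
  define d where "d = S (X y) - X (T y)"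
  \<comment> \<open>A bound for the function \<open>F\<close> below on the disc of radius 1 / sqrt
    n, uniform in n because (1 + R^2 / n)^n <= exp (R^2).\<close>
  define C where "C = exp (R\<^sup>2) * norm y * K"
  have est: "real n * norm d \<le> C * sqrt n" if n: "0 < n" for n
  proof -
    let ?L = "\<lambda>x. (-1) *\<^sub>C T x"
    obtain g' where g: "weak_deriv (\<lambda>w. (add_scaled ?L w ^^ n) y) g'"
      and g0: "g' 0 = 0 + of_nat n *\<^sub>C ?L y"
      using weak_deriv_funpow_add_scaled[OF bounded_clinear_scaleC[OF T] weak_deriv_const] by blast
    define F where "F w = (add_scaled S w ^^ n) (X ((add_scaled ?L w ^^ n) y))" for w
    obtain F' where F: "weak_deriv F F'"
      and F0: "F' 0 = X (g' 0) + of_nat n *\<^sub>C S (X ((add_scaled ?L 0 ^^ n) y))"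
      using weak_deriv_funpow_add_scaled[OF S weak_deriv_bounded_clinear[OF X g]]
      unfolding F_def by blast
    \<comment> \<open>The outer iterate contributes n S (X y), the inner one -n X (T y).\<close>
    have "F' 0 = of_nat n *\<^sub>C d"
      by (simp add: F0 g0 d_def X.scaleC X.neg scaleC_minus_one flip: scaleC_add_right)
    moreover have "norm (F' 0) \<le> C / (1 / sqrt n)"
    proof (rule weak_deriv_Cauchy_bound[OF F])
      fix w assume w: "cmod w \<le> 1 / sqrt n"
      have "(cmod w * R)\<^sup>2 \<le> (1 / sqrt n * R)\<^sup>2"
        using w R(1) by (intro power_mono mult_right_mono) simp_all
      also have "\<dots> = R\<^sup>2 / n"
        by (simp add: power_mult_distrib power_divide)
      finally have "(1 + (cmod w * R)\<^sup>2) ^ n \<le> (1 + R\<^sup>2 / n) ^ n"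
        by (intro power_mono) simp_all
      also have "\<dots> \<le> exp (R\<^sup>2)"
        using n order_trans[of "- real n" 0 "R\<^sup>2"]
          by (intro exp_ge_one_plus_x_over_n_power_n) simp_all
      finally have pow: "(1 + (cmod w * R)\<^sup>2) ^ n \<le> exp (R\<^sup>2)" .
      \<comment> \<open>The powers of 1 + w S outside \<open>X\<close> are traded for powers of 1 +
        w T, which then meet those of 1 - w T.\<close>
      have "norm (F w) \<le> norm ((add_scaled T w ^^ n) ((add_scaled ?L w ^^ n) y)) * K"
        unfolding F_def S_def T_def
        by (rule norm_funpow_add_scaled_intertwine_le[OF M N X MX K(2)])
      also have "\<dots> \<le> (1 + (cmod w * R)\<^sup>2) ^ n * norm y * K"
        using K(1) R(1) norm_funpow_add_scaled_minus_le[OF T R(2)]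
        by (intro mult_right_mono) simp_all
      also have "\<dots> \<le> C"
        unfolding C_def using pow K(1) by (intro mult_right_mono) simp_all
      finally show "norm (F w) \<le> C" .
    qed (use n in simp)
    ultimately show ?thesis
      by (simp add: norm_scaleC)
  qed
  have "d = 0"
  proof (rule ccontr)
    assume "d \<noteq> 0"
    \<comment> \<open>Large enough that sqrt n exceeds C / norm d, whereas \<open>est\<close>
      divided by sqrt n gives sqrt n * norm d <= C.\<close>
    define n where "n = nat \<lceil>(C / norm d)\<^sup>2\<rceil> + 1"
    have n: "0 < n" "(C / norm d)\<^sup>2 < n"
      unfolding n_def by (simp, linarith)
    have "sqrt n * (sqrt n * norm d) \<le> sqrt n * C"
      using est[OF n(1)] unfolding mult.assoc[symmetric] real_sqrt_mult_self
      by (simp add: mult.commute)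
    then have "sqrt n * norm d \<le> C"
      using n(1) by (subst (asm) mult_le_cancel_left_pos) simp_all
    then have "sqrt n \<le> C / norm d"
      using \<open>d \<noteq> 0\<close> by (simp add: le_divide_eq)
    then have "real n \<le> (C / norm d)\<^sup>2"
      using power_mono[of "sqrt n" "C / norm d" 2] by simp
    with n(2) show False by simp
  qed
  then show ?thesis
    by (simp add: d_def S_def T_def)
qed

section \<open>Normality of the products A B and B A\<close>

theorem theorem2p1:
  fixes A B :: "'a::complex_hilbert_space \<Rightarrow> 'a" and lam :: complex
  assumes "normal_operator A" and "normal_operator B"
    and "A \<circ> B = (\<lambda>x. lam *\<^sub>C (B \<circ> A) x)"
    and "A \<circ> B \<noteq> (\<lambda>x. 0)"
  shows "normal_operator (A \<circ> B) \<and> normal_operator (B \<circ> A)"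
proof -
  have A: "bounded_clinear A" and commA: "A (cadjoint A x) = cadjoint A (A x)"
    and B: "bounded_clinear B" and commB: "B (cadjoint B x) = cadjoint B (B x)" for x
    using assms(1,2) by (auto simp: normal_operator_def fun_eq_iff)
  have lam: "lam \<noteq> 0"
    using assms(3,4) by auto
  have AB: "A (B x) = lam *\<^sub>C B (A x)" for x
    using assms(3) by (simp add: fun_eq_iff)
  interpret A: bounded_clinear A by fact
  interpret B': bounded_clinear "cadjoint B" by (rule bounded_clinear_cadjoint[OF B])
  \<comment> \<open>Fuglede-Putnam with M = lam B, N = B, X = A.\<close>
  have B'A: "cnj lam *\<^sub>C cadjoint B (A x) = A (cadjoint B x)" for x
    using Fuglede_Putnam[OF normal_operator_scaleC[OF assms(2)] assms(2) A, of lam x]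
    by (simp add: AB cadjoint_scaleC[OF B])
  \<comment> \<open>Fuglede-Putnam with M = A, N = lam A, X = B.\<close>
  have A'B: "cadjoint A (B x) = cnj lam *\<^sub>C B (cadjoint A x)" for x
    using Fuglede_Putnam[OF assms(1) normal_operator_scaleC[OF assms(1)] B, of lam x]
      bounded_clinear.scaleC[OF B]
    by (simp add: AB cadjoint_scaleC[OF A])
  have "cadjoint B (cadjoint A (A (B x))) = A (B (cadjoint B (cadjoint A x)))" for x
  proof -
    \<comment> \<open>The factor \<open>cnj lam\<close> produced by \<open>A'B\<close> is absorbed
      again by \<open>B'A\<close>; normality of A and of B supplies the two remaining
      exchanges.\<close>
    have "cadjoint B (cadjoint A (A (B x))) = cadjoint B (A (cnj lam *\<^sub>C B (cadjoint A x)))"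
      by (simp add: A'B flip: commA)
    also have "\<dots> = A (cadjoint B (B (cadjoint A x)))"
      by (simp add: A.scaleC B'.scaleC B'A)
    finally show ?thesis
      by (simp add: commB)
  qed
  then have nAB: "normal_operator (A \<circ> B)"
    by (simp add: normal_operator_def bounded_clinear_compose[OF A B] cadjoint_compose[OF A B]
        fun_eq_iff)
  have "B \<circ> A = (\<lambda>x. inverse lam *\<^sub>C (A \<circ> B) x)"
    using lam by (simp add: fun_eq_iff AB scaleC_scaleC)
  with nAB normal_operator_scaleC[OF nAB, of "inverse lam"] show ?thesis
    by simp
qed

end
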